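(* Let $n$ be odd. The following quantities are all equal: (i) the number of species containing symmetric Latin squares of order $n$; (ii) the number of species containing diagonal symmetric Latin squares of order $n$; (iii) the number of species containing idempotent symmetric Latin squares of order $n$; (iv) the number of isotopism classes containing idempotent symmetric Latin squares of order $n$; (v) the number of rrs-isotopism classes containing idempotent symmetric Latin squares of order $n$; (vi) the number of isomorphism classes of idempotent symmetric Latin squares of order $n$; (vii) the number of isomorphism classes containing unipotent symmetric reduced Latin squares of order $n+1$.
   Context: A Latin square of order $n$ is a set of $n^2$ triples (row, column, symbol) over $\{1,\dots,n\}$, distinct triples agreeing in at most one coordinate; it is symmetric if it equals its transpose; reduced if its first row and column are $1,\dots,n$ in order; unipotent if all main diagonal entries are equal; diagonal if the main diagonal entries are distinct; idempotent if cell $(i,i)$ contains $i$ for all $i$. An isotopism $(\alpha,\beta,\gamma)\in\mathcal{S}_n^3$ maps $(r,c,s)$ to $(r^\alpha,c^\beta,s^\gamma)$; it is an rrs-isotopism if $\alpha=\beta$ and an isomorphism if $\alpha=\beta=\gamma$. A paratopism is an isotopism combined with a uniform permutation of the three coordinates of all triples; species are paratopism classes. A class "containing" squares with a property means a class containing at least one such square. *)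

theory Defs
  imports Main "HOL-Combinatorics.Permutations"
begin

type_synonym triple = "nat \<times> nat \<times> nat"

fun coord :: "triple \<Rightarrow> nat \<Rightarrow> nat" where
  "coord (r, c, s) i = (if i = 1 then r else if i = 2 then c else s)"

definition latin_square :: "nat \<Rightarrow> triple set \<Rightarrow> bool" where
  "latin_square n L \<longleftrightarrow>
     L \<subseteq> {1..n} \<times> {1..n} \<times> {1..n} \<and> card L = n\<^sup>2 \<and>
     (\<forall>t\<in>L. \<forall>u\<in>L. t \<noteq> u \<longrightarrow> card {i \<in> {1, 2, 3}. coord t i = coord u i} \<le> 1)"

definition latin_squares :: "nat \<Rightarrow> triple set set" where
  "latin_squares n = {L. latin_square n L}"

definition transpose_sq :: "triple set \<Rightarrow> triple set" where
  "transpose_sq L = (\<lambda>(r, c, s). (c, r, s)) ` L"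

definition symmetric_sq :: "triple set \<Rightarrow> bool" where
  "symmetric_sq L \<longleftrightarrow> transpose_sq L = L"

definition reduced_sq :: "nat \<Rightarrow> triple set \<Rightarrow> bool" where
  "reduced_sq n L \<longleftrightarrow> (\<forall>i\<in>{1..n}. (1, i, i) \<in> L \<and> (i, 1, i) \<in> L)"

definition unipotent_sq :: "triple set \<Rightarrow> bool" where
  "unipotent_sq L \<longleftrightarrow> (\<forall>i j s t. (i, i, s) \<in> L \<longrightarrow> (j, j, t) \<in> L \<longrightarrow> s = t)"

definition diagonal_sq :: "triple set \<Rightarrow> bool" where
  "diagonal_sq L \<longleftrightarrow>
     (\<forall>i j s t. (i, i, s) \<in> L \<longrightarrow> (j, j, t) \<in> L \<longrightarrow> i \<noteq> j \<longrightarrow> s \<noteq> t)"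

definition idempotent_sq :: "nat \<Rightarrow> triple set \<Rightarrow> bool" where
  "idempotent_sq n L \<longleftrightarrow> (\<forall>i\<in>{1..n}. (i, i, i) \<in> L)"

definition isotope ::
  "(nat \<Rightarrow> nat) \<Rightarrow> (nat \<Rightarrow> nat) \<Rightarrow> (nat \<Rightarrow> nat) \<Rightarrow> triple set \<Rightarrow> triple set" where
  "isotope \<alpha> \<beta> \<gamma> L = (\<lambda>(r, c, s). (\<alpha> r, \<beta> c, \<gamma> s)) ` L"

definition conjugate_sq :: "(nat \<Rightarrow> nat) \<Rightarrow> triple set \<Rightarrow> triple set" where
  "conjugate_sq \<pi> L = (\<lambda>t. (coord t (\<pi> 1), coord t (\<pi> 2), coord t (\<pi> 3))) ` L"

definition isotopic :: "nat \<Rightarrow> (triple set \<times> triple set) set" where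
  "isotopic n = {(L, M). L \<in> latin_squares n \<and> M \<in> latin_squares n \<and>
     (\<exists>\<alpha> \<beta> \<gamma>. \<alpha> permutes {1..n} \<and> \<beta> permutes {1..n} \<and> \<gamma> permutes {1..n} \<and>
        M = isotope \<alpha> \<beta> \<gamma> L)}"

definition rrs_isotopic :: "nat \<Rightarrow> (triple set \<times> triple set) set" where
  "rrs_isotopic n = {(L, M). L \<in> latin_squares n \<and> M \<in> latin_squares n \<and>
     (\<exists>\<alpha> \<gamma>. \<alpha> permutes {1..n} \<and> \<gamma> permutes {1..n} \<and> M = isotope \<alpha> \<alpha> \<gamma> L)}"

definition isomorphic :: "nat \<Rightarrow> (triple set \<times> triple set) set" where
  "isomorphic n = {(L, M). L \<in> latin_squares n \<and> M \<in> latin_squares n \<and>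
     (\<exists>\<alpha>. \<alpha> permutes {1..n} \<and> M = isotope \<alpha> \<alpha> \<alpha> L)}"

definition paratopic :: "nat \<Rightarrow> (triple set \<times> triple set) set" where
  "paratopic n = {(L, M). L \<in> latin_squares n \<and> M \<in> latin_squares n \<and>
     (\<exists>\<alpha> \<beta> \<gamma> \<pi>. \<alpha> permutes {1..n} \<and> \<beta> permutes {1..n} \<and> \<gamma> permutes {1..n} \<and>
        \<pi> permutes {1, 2, 3} \<and> M = conjugate_sq \<pi> (isotope \<alpha> \<beta> \<gamma> L))}"

definition classes_containing ::
  "nat \<Rightarrow> (triple set \<times> triple set) set \<Rightarrow> (triple set \<Rightarrow> bool) \<Rightarrow> triple set set set" where
  "classes_containing n R P = {C \<in> latin_squares n // R. \<exists>L\<in>C. P L}"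

end

theory Submission
  imports Defs "HOL-Combinatorics.Cycles"
begin

text \<open>
  In a symmetric square of odd order every symbol occurs an odd number of times, hence on the
  diagonal, so relabelling symbols makes the square idempotent. If \<open>(\<alpha>, \<beta>, \<gamma>)\<close> maps a
  symmetric square \<open>L\<close> to a symmetric square, then \<open>(\<theta>, \<theta>\<^sup>-\<^sup>1, 1)\<close> with
  \<open>\<theta> = \<alpha>\<^sup>-\<^sup>1 \<beta>\<close> is an autotopism of \<open>L\<close>. A power of \<open>\<theta>\<close> that is an involution would fix the
  distinct diagonal symbols and hence be trivial, so \<open>\<theta>\<close> has odd order and a square root \<open>\<phi>\<close>
  among its powers; then \<open>(\<alpha>\<phi>, \<alpha>\<phi>, \<gamma>)\<close> is another isotopism between the two squares, and
  idempotency forces \<open>\<gamma> = \<alpha>\<phi>\<close>. A symmetric square that is paratopic to a symmetric square by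
  a paratopism moving the symbol coordinate is isotopic to all its conjugates, because two
  different transpositions generate the symmetric group on the coordinates. Finally, moving the
  diagonal of an idempotent square to a new row and column, and filling it with a new symbol,
  gives the unipotent reduced squares of order \<open>n + 1\<close>, where isomorphisms must fix the new symbol.
\<close>

section \<open>Counting classes\<close>

text \<open>Since \<open>f\<close> and \<open>g\<close> identify the same pairs in \<open>A\<close>,
  sending \<open>f x\<close> to \<open>g x\<close> is a well-defined bijection between the
  images.\<close>

lemma card_image_eq_if_same_kernel:
  assumes "\<And>x y. x \<in> A \<Longrightarrow> y \<in> A \<Longrightarrow> f x = f y \<longleftrightarrow> g x = g y"
  shows "card (f ` A) = card (g ` A)"
proof (rule bij_betw_same_card)
  have inv: "inv_into A f (f x) \<in> A \<and> f (inv_into A f (f x)) = f x" if "x \<in> A" for x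
    using that by (simp add: f_inv_into_f inv_into_into)
  \<comment> \<open>The chosen preimage may differ from \<open>x\<close>, but it lies in the same
    fibre of \<open>f\<close>, hence of \<open>g\<close>.\<close>
  then have eq: "g (inv_into A f (f x)) = g x" if "x \<in> A" for x
    using that assms by metis
  show "bij_betw (\<lambda>c. g (inv_into A f c)) (f ` A) (g ` A)"
  proof (rule bij_betw_imageI)
    show "inj_on (\<lambda>c. g (inv_into A f c)) (f ` A)"
      by (rule inj_onI) (use assms eq in auto)
    show "(\<lambda>c. g (inv_into A f c)) ` f ` A = g ` A"
      by (simp add: image_image eq cong: image_cong)
  qed
qed

text \<open>The common tool for comparing counts. \<open>A // R\<close> consists of the full
  \<open>R\<close>-classes of \<open>X\<close> that meet \<open>A\<close>; a map that preserves and
  reflects the relations, and reaches every \<open>S\<close>-class meeting \<open>B\<close>, induces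
  a bijection of classes.\<close>

lemma card_quotient_eq:
  assumes "equiv X R" "equiv Y S" "A \<subseteq> X" "B \<subseteq> Y" "f ` A \<subseteq> B"
    and iff: "\<And>x y. x \<in> A \<Longrightarrow> y \<in> A \<Longrightarrow> (x, y) \<in> R \<longleftrightarrow> (f x, f y) \<in> S"
    and ex: "\<And>y. y \<in> B \<Longrightarrow> \<exists>x\<in>A. (f x, y) \<in> S"
  shows "card (A // R) = card (B // S)"
proof -
  have AR: "A // R = (\<lambda>x. R `` {x}) ` A"
    by (auto simp: quotient_def)
  have BS: "B // S = (\<lambda>x. S `` {f x}) ` A"
  proof
    show "B // S \<subseteq> (\<lambda>x. S `` {f x}) ` A"
    proof
      fix C assume "C \<in> B // S"
      then obtain y where y: "y \<in> B" "C = S `` {y}"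
        by (auto simp: quotient_def)
      with ex obtain x where "x \<in> A" "(f x, y) \<in> S" by blast
      with y assms(2) show "C \<in> (\<lambda>x. S `` {f x}) ` A"
        using equiv_class_eq[of Y S "f x" y] by blast
    qed
    show "(\<lambda>x. S `` {f x}) ` A \<subseteq> B // S"
      using assms(5) by (auto simp: quotient_def)
  qed
  have "R `` {x} = R `` {y} \<longleftrightarrow> S `` {f x} = S `` {f y}" if "x \<in> A" "y \<in> A" for x y
  proof -
    have "R `` {x} = R `` {y} \<longleftrightarrow> (x, y) \<in> R"
      using eq_equiv_class_iff[OF assms(1)] that assms(3) by blast
    moreover have "S `` {f x} = S `` {f y} \<longleftrightarrow> (f x, f y) \<in> S"
      using eq_equiv_class_iff[OF assms(2)] that assms(4,5) by blast
    ultimately show ?thesis using iff that by simp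
  qed
  then show ?thesis
    unfolding AR BS by (rule card_image_eq_if_same_kernel)
qed

text \<open>\<open>F\<close> behaves as a group of maps, so its orbits give an equivalence; the maps
  act on all objects, and requiring both endpoints in \<open>X\<close> restricts the relation to
  \<open>X\<close>.\<close>

lemma equiv_orbit_relation:
  assumes "id \<in> F" "\<And>f g. f \<in> F \<Longrightarrow> g \<in> F \<Longrightarrow> f \<circ> g \<in> F"
    and "\<And>f. f \<in> F \<Longrightarrow> \<exists>g\<in>F. g \<circ> f = id"
  shows "equiv X {(x, y). x \<in> X \<and> y \<in> X \<and> (\<exists>f\<in>F. y = f x)}" (is "equiv X ?R")
proof (rule equivI)
  show "?R \<subseteq> X \<times> X" by auto
  show "refl_on X ?R" using assms(1) by (auto simp: refl_on_def intro: bexI[of _ id])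
  show "sym ?R"
  proof (rule symI)
    fix x y assume "(x, y) \<in> ?R"
    then obtain f where f: "x \<in> X" "y \<in> X" "f \<in> F" "y = f x" by auto
    then obtain g where "g \<in> F" "g \<circ> f = id" using assms(3) by blast
    with f show "(y, x) \<in> ?R" by (auto simp: fun_eq_iff intro!: bexI[of _ g])
  qed
  show "trans ?R"
  proof (rule transI)
    fix x y z assume "(x, y) \<in> ?R" "(y, z) \<in> ?R"
    then obtain f g where "x \<in> X" "z \<in> X" "f \<in> F" "g \<in> F" "z = g (f x)" by auto
    with assms(2)[of g f] show "(x, z) \<in> ?R" by (auto intro!: bexI[of _ "g \<circ> f"])
  qed
qed

text \<open>A class is generated by any of its members, in particular by one satisfying
  \<open>P\<close>. This brings the counts into the form that \<open>card_quotient_eq\<close>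
  handles.\<close>

lemma classes_containing_eq_quotient:
  assumes "equiv (latin_squares n) R"
  shows "classes_containing n R P = {L \<in> latin_squares n. P L} // R"
proof
  show "classes_containing n R P \<subseteq> {L \<in> latin_squares n. P L} // R"
  proof
    fix C assume "C \<in> classes_containing n R P"
    then obtain L where C: "C \<in> latin_squares n // R" "L \<in> C" "P L"
      by (auto simp: classes_containing_def)
    then obtain K where K: "C = R `` {K}" by (auto simp: quotient_def)
    with C have "(K, L) \<in> R" by simp
    then have "C = R `` {L}" "L \<in> latin_squares n"
      using K assms by (auto simp: equiv_class_eq dest: equivE)
    with C show "C \<in> {L \<in> latin_squares n. P L} // R"
      by (auto simp: quotient_def)
  qed
  show "{L \<in> latin_squares n. P L} // R \<subseteq> classes_containing n R P"
    using equiv_class_self[OF assms]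
    by (fastforce simp: classes_containing_def quotient_def)
qed

section \<open>Isotopisms and conjugates\<close>

text \<open>Taken as maps on arbitrary triple sets, so that the group laws become equations between
  functions.\<close>

definition isotopisms :: "nat \<Rightarrow> (triple set \<Rightarrow> triple set) set" where
  "isotopisms n = {isotope \<alpha> \<beta> \<gamma> | \<alpha> \<beta> \<gamma>.
     \<alpha> permutes {1..n} \<and> \<beta> permutes {1..n} \<and> \<gamma> permutes {1..n}}"

lemma isotope_comp:
  "isotope \<alpha> \<beta> \<gamma> \<circ> isotope \<alpha>' \<beta>' \<gamma>' = isotope (\<alpha> \<circ> \<alpha>') (\<beta> \<circ> \<beta>') (\<gamma> \<circ> \<gamma>')"
  by (rule ext) (auto simp: isotope_def image_image case_prod_unfold)

lemma isotope_id: "isotope id id id = id"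
  by (rule ext) (auto simp: isotope_def)

lemma isotope_inv:
  assumes "\<alpha> permutes S" "\<beta> permutes T" "\<gamma> permutes U"
  shows "isotope (inv \<alpha>) (inv \<beta>) (inv \<gamma>) \<circ> isotope \<alpha> \<beta> \<gamma> = id"
  using assms by (simp add: isotope_comp permutes_inv_o isotope_id)

lemma isotope_mem:
  "(r, c, s) \<in> L \<Longrightarrow> (\<alpha> r, \<beta> c, \<gamma> s) \<in> isotope \<alpha> \<beta> \<gamma> L"
  by (force simp: isotope_def)

lemma isotope_mem_inv:
  assumes "\<alpha> permutes S" "\<beta> permutes T" "\<gamma> permutes U" "(r, c, s) \<in> isotope \<alpha> \<beta> \<gamma> L"
  shows "(inv \<alpha> r, inv \<beta> c, inv \<gamma> s) \<in> L"
  using assms by (auto simp: isotope_def permutes_inverses)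

lemma isotopisms_id: "id \<in> isotopisms n"
  unfolding isotopisms_def using isotope_id permutes_id by (metis (mono_tags, lifting) mem_Collect_eq)

lemma isotopisms_comp:
  assumes "i \<in> isotopisms n" "j \<in> isotopisms n"
  shows "i \<circ> j \<in> isotopisms n"
  using assms unfolding isotopisms_def by (force simp: isotope_comp intro: permutes_compose)

lemma isotopisms_inv:
  assumes "i \<in> isotopisms n"
  shows "\<exists>j\<in>isotopisms n. j \<circ> i = id"
  using assms unfolding isotopisms_def
  by clarsimp (metis isotope_inv permutes_inv)

section \<open>Permuting the coordinates\<close>

lemma coord_apply:
  "j \<in> {1, 2, 3} \<Longrightarrow> coord (f 1 r, f 2 c, f 3 s) j = f j (coord (r, c, s) j)"
  by auto

text \<open>Position \<open>i\<close> of the conjugate holds the old coordinate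
  \<open>\<pi> i\<close>, so the permutation \<open>f (\<pi> i)\<close> of that coordinate travels
  with it.\<close>

lemma conjugate_isotope:
  assumes "\<pi> permutes {1, 2, 3}"
  shows "conjugate_sq \<pi> (isotope (f 1) (f 2) (f 3) L) =
    isotope (f (\<pi> 1)) (f (\<pi> 2)) (f (\<pi> 3)) (conjugate_sq \<pi> L)"
proof -
  \<comment> \<open>\<open>coord\<close> returns the symbol at every index other than 1 and 2, so
    \<open>coord_apply\<close> is restricted to genuine indices.\<close>
  have "\<pi> 1 \<in> {1, 2, 3}" "\<pi> 2 \<in> {1, 2, 3}" "\<pi> 3 \<in> {1, 2, 3}"
    using permutes_in_image[OF assms] by blast+
  note eq = this[THEN coord_apply]
  show ?thesis
    unfolding conjugate_sq_def isotope_def image_image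
  proof (rule image_cong)
    fix t assume "t \<in> L"
    obtain r c s where "t = (r, c, s)" by (cases t)
    then show "(coord (case t of (r, c, s) \<Rightarrow> (f 1 r, f 2 c, f 3 s)) (\<pi> 1),
        coord (case t of (r, c, s) \<Rightarrow> (f 1 r, f 2 c, f 3 s)) (\<pi> 2),
        coord (case t of (r, c, s) \<Rightarrow> (f 1 r, f 2 c, f 3 s)) (\<pi> 3)) =
      (case (coord t (\<pi> 1), coord t (\<pi> 2), coord t (\<pi> 3)) of
        (r, c, s) \<Rightarrow> (f (\<pi> 1) r, f (\<pi> 2) c, f (\<pi> 3) s))"
      by (simp only: prod.case eq)
  qed simp
qed

text \<open>The order reverses because \<open>conjugate_sq\<close> reads coordinates: position
  \<open>i\<close> of the outer conjugate asks for coordinate \<open>\<pi> i\<close> of the inner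
  one, which is the original coordinate \<open>\<rho> (\<pi> i)\<close>.\<close>

lemma conjugate_comp:
  assumes "\<pi> permutes {1, 2, 3}"
  shows "conjugate_sq \<pi> \<circ> conjugate_sq \<rho> = conjugate_sq (\<rho> \<circ> \<pi>)"
proof -
  have eq: "coord (coord t (\<rho> 1), coord t (\<rho> 2), coord t (\<rho> 3)) (\<pi> i) = coord t (\<rho> (\<pi> i))"
    if "i \<in> {1, 2, 3}" for t i
  proof -
    have "\<pi> i \<in> {1, 2, 3}" using that permutes_in_image[OF assms] by blast
    then show ?thesis by auto
  qed
  show ?thesis
    using eq[of 1] eq[of 2] eq[of 3]
    by (intro ext) (simp add: conjugate_sq_def image_image del: coord.simps)
qed

lemma conjugate_id: "conjugate_sq id = id"
  by (rule ext) (force simp: conjugate_sq_def image_def)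

lemma conjugate_isotopism_commute:
  assumes "\<pi> permutes {1, 2, 3}" "i \<in> isotopisms n"
  obtains j where "j \<in> isotopisms n" "conjugate_sq \<pi> \<circ> i = j \<circ> conjugate_sq \<pi>"
proof -
  from assms(2) obtain \<alpha> \<beta> \<gamma> where i: "i = isotope \<alpha> \<beta> \<gamma>"
      "\<alpha> permutes {1..n}" "\<beta> permutes {1..n}" "\<gamma> permutes {1..n}"
    by (auto simp: isotopisms_def)
  \<comment> \<open>Indexing the three permutations by coordinate lets \<open>\<pi>\<close>
    rearrange them; every \<open>f k\<close> permutes \<open>{1..n}\<close>.\<close>
  define f where "f = (\<lambda>k::nat. if k = 1 then \<alpha> else if k = 2 then \<beta> else \<gamma>)"
  have "isotope (f (\<pi> 1)) (f (\<pi> 2)) (f (\<pi> 3)) \<in> isotopisms n"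
    unfolding isotopisms_def using i by (auto simp: f_def)
  moreover have "conjugate_sq \<pi> \<circ> i = isotope (f (\<pi> 1)) (f (\<pi> 2)) (f (\<pi> 3)) \<circ> conjugate_sq \<pi>"
    using conjugate_isotope[OF assms(1), of f] by (auto simp: f_def i)
  ultimately show ?thesis using that by blast
qed

section \<open>The group of paratopisms\<close>

definition paratopisms :: "nat \<Rightarrow> (triple set \<Rightarrow> triple set) set" where
  "paratopisms n = {conjugate_sq \<pi> \<circ> i | \<pi> i. \<pi> permutes {1, 2, 3} \<and> i \<in> isotopisms n}"

text \<open>Conjugations normalise the isotopisms, so a product in the opposite order also has the
  normal form with the isotopism applied first.\<close>

lemma paratopisms_conjugate_right:
  assumes "\<pi> permutes {1, 2, 3}" "i \<in> isotopisms n"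
  shows "i \<circ> conjugate_sq \<pi> \<in> paratopisms n"
proof -
  have inv: "inv \<pi> permutes {1, 2, 3}" using assms(1) by (rule permutes_inv)
  obtain j where j: "j \<in> isotopisms n" "conjugate_sq (inv \<pi>) \<circ> i = j \<circ> conjugate_sq (inv \<pi>)"
    using conjugate_isotopism_commute[OF inv assms(2)] .
  \<comment> \<open>Multiplying the commutation rule for \<open>inv \<pi>\<close> by
    \<open>conjugate_sq \<pi>\<close> on both sides cancels the inverse pairs.\<close>
  have "conjugate_sq \<pi> \<circ> (conjugate_sq (inv \<pi>) \<circ> i) \<circ> conjugate_sq \<pi> =
      conjugate_sq \<pi> \<circ> (j \<circ> conjugate_sq (inv \<pi>)) \<circ> conjugate_sq \<pi>"
    using j by simp
  then have "(conjugate_sq \<pi> \<circ> conjugate_sq (inv \<pi>)) \<circ> i \<circ> conjugate_sq \<pi> =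
      conjugate_sq \<pi> \<circ> j \<circ> (conjugate_sq (inv \<pi>) \<circ> conjugate_sq \<pi>)"
    by (simp only: o_assoc)
  then have "i \<circ> conjugate_sq \<pi> = conjugate_sq \<pi> \<circ> j"
    using assms(1) inv by (simp add: conjugate_comp permutes_inv_o conjugate_id)
  with j assms show ?thesis by (auto simp: paratopisms_def)
qed

lemma paratopisms_id: "id \<in> paratopisms n"
  unfolding paratopisms_def
  by (metis (mono_tags, lifting) comp_id conjugate_id isotopisms_id mem_Collect_eq permutes_id)

lemma paratopisms_comp:
  assumes "f \<in> paratopisms n" "g \<in> paratopisms n"
  shows "f \<circ> g \<in> paratopisms n"
proof -
  obtain \<pi> i \<rho> j where f: "\<pi> permutes {1, 2, 3}" "i \<in> isotopisms n" "f = conjugate_sq \<pi> \<circ> i"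
    and g: "\<rho> permutes {1, 2, 3}" "j \<in> isotopisms n" "g = conjugate_sq \<rho> \<circ> j"
    using assms by (auto simp: paratopisms_def)
  obtain \<rho>' k where k: "\<rho>' permutes {1, 2, 3}" "k \<in> isotopisms n"
      "i \<circ> conjugate_sq \<rho> = conjugate_sq \<rho>' \<circ> k"
    using paratopisms_conjugate_right[OF g(1) f(2)] by (auto simp: paratopisms_def)
  have "f \<circ> g = conjugate_sq \<pi> \<circ> (i \<circ> conjugate_sq \<rho>) \<circ> j"
    by (simp add: f g o_assoc)
  also have "\<dots> = (conjugate_sq \<pi> \<circ> conjugate_sq \<rho>') \<circ> (k \<circ> j)"
    unfolding k by (simp add: o_assoc)
  also have "\<dots> = conjugate_sq (\<rho>' \<circ> \<pi>) \<circ> (k \<circ> j)"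
    using f(1) by (simp add: conjugate_comp)
  finally show ?thesis
    using permutes_compose[OF f(1) k(1)] isotopisms_comp[OF k(2) g(2)]
    by (auto simp: paratopisms_def)
qed

lemma paratopisms_inv:
  assumes "f \<in> paratopisms n"
  shows "\<exists>g\<in>paratopisms n. g \<circ> f = id"
proof -
  obtain \<pi> i where f: "\<pi> permutes {1, 2, 3}" "i \<in> isotopisms n" "f = conjugate_sq \<pi> \<circ> i"
    using assms by (auto simp: paratopisms_def)
  obtain j where j: "j \<in> isotopisms n" "j \<circ> i = id" using isotopisms_inv[OF f(2)] by blast
  have "j \<circ> conjugate_sq (inv \<pi>) \<circ> f = j \<circ> (conjugate_sq (inv \<pi>) \<circ> conjugate_sq \<pi>) \<circ> i"
    by (simp add: f o_assoc)
  also have "\<dots> = id"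
    using f j by (simp add: conjugate_comp permutes_inv permutes_inv_o conjugate_id)
  finally show ?thesis
    using paratopisms_conjugate_right[OF permutes_inv[OF f(1)] j(1)] by blast
qed

section \<open>The four relations are equivalences\<close>

lemma isotopic_alt:
  "isotopic n = {(L, M). L \<in> latin_squares n \<and> M \<in> latin_squares n \<and> (\<exists>i\<in>isotopisms n. M = i L)}"
  unfolding isotopic_def isotopisms_def by blast

lemma paratopic_alt:
  "paratopic n = {(L, M). L \<in> latin_squares n \<and> M \<in> latin_squares n \<and> (\<exists>f\<in>paratopisms n. M = f L)}"
  unfolding paratopic_def paratopisms_def isotopisms_def by fastforce

lemma equiv_isotopic: "equiv (latin_squares n) (isotopic n)"
  unfolding isotopic_alt
  by (intro equiv_orbit_relation isotopisms_id isotopisms_comp isotopisms_inv)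

lemma equiv_paratopic: "equiv (latin_squares n) (paratopic n)"
  unfolding paratopic_alt
  by (intro equiv_orbit_relation paratopisms_id paratopisms_comp paratopisms_inv)

lemma equiv_rrs_isotopic: "equiv (latin_squares n) (rrs_isotopic n)"
proof -
  define F where "F = {isotope \<alpha> \<alpha> \<gamma> | \<alpha> \<gamma>. \<alpha> permutes {1..n} \<and> \<gamma> permutes {1..n}}"
  have "rrs_isotopic n =
      {(L, M). L \<in> latin_squares n \<and> M \<in> latin_squares n \<and> (\<exists>f\<in>F. M = f L)}"
    unfolding rrs_isotopic_def F_def by blast
  moreover have "id \<in> F"
    unfolding F_def using isotope_id permutes_id by (metis (mono_tags, lifting) mem_Collect_eq)
  moreover have "f \<circ> g \<in> F" if "f \<in> F" "g \<in> F" for f g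
    using that unfolding F_def by (force simp: isotope_comp intro: permutes_compose)
  moreover have "\<exists>g\<in>F. g \<circ> f = id" if "f \<in> F" for f
    using that unfolding F_def by clarsimp (metis isotope_inv permutes_inv)
  ultimately show ?thesis by (simp add: equiv_orbit_relation)
qed

lemma equiv_isomorphic: "equiv (latin_squares n) (isomorphic n)"
proof -
  define F where "F = {isotope \<alpha> \<alpha> \<alpha> | \<alpha>. \<alpha> permutes {1..n}}"
  have "isomorphic n =
      {(L, M). L \<in> latin_squares n \<and> M \<in> latin_squares n \<and> (\<exists>f\<in>F. M = f L)}"
    unfolding isomorphic_def F_def by blast
  moreover have "id \<in> F"
    unfolding F_def using isotope_id permutes_id by (metis (mono_tags, lifting) mem_Collect_eq)
  moreover have "f \<circ> g \<in> F" if "f \<in> F" "g \<in> F" for f g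
    using that unfolding F_def by (force simp: isotope_comp intro: permutes_compose)
  moreover have "\<exists>g\<in>F. g \<circ> f = id" if "f \<in> F" for f
    using that unfolding F_def by clarsimp (metis isotope_inv permutes_inv)
  ultimately show ?thesis by (simp add: equiv_orbit_relation)
qed

section \<open>Paratopic symmetric squares are isotopic\<close>

text \<open>The adjacent transpositions generate the symmetric group on the coordinates. Words in
  them suit symmetric squares, on which \<open>t\<close> acts trivially.\<close>

lemma permutes_3_cases:
  assumes "\<pi> permutes {1, 2, 3::nat}"
  defines "t \<equiv> transpose 1 2" and "u \<equiv> transpose 2 3"
  shows "\<pi> \<in> {id, t, u, t \<circ> u, u \<circ> t, t \<circ> u \<circ> t}"
proof -
  have im: "\<pi> 1 \<in> {1, 2, 3}" "\<pi> 2 \<in> {1, 2, 3}" "\<pi> 3 \<in> {1, 2, 3}"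
    using permutes_in_image[OF assms(1)] by blast+
  have inj: "\<pi> 1 \<noteq> \<pi> 2" "\<pi> 1 \<noteq> \<pi> 3" "\<pi> 2 \<noteq> \<pi> 3"
    using permutes_inj[OF assms(1)] by (simp_all add: inj_eq)
  have eqI: "\<pi> = \<sigma>" if "\<pi> 1 = \<sigma> 1" "\<pi> 2 = \<sigma> 2" "\<pi> 3 = \<sigma> 3"
    "\<And>x. x \<notin> {1, 2, 3} \<Longrightarrow> \<sigma> x = x" for \<sigma>
  proof
    fix x show "\<pi> x = \<sigma> x"
      using that permutes_not_in[OF assms(1), of x] by (cases "x \<in> {1, 2, 3}") auto
  qed
  consider "\<pi> 1 = 1" "\<pi> 2 = 2" "\<pi> 3 = 3" | "\<pi> 1 = 2" "\<pi> 2 = 1" "\<pi> 3 = 3"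
    | "\<pi> 1 = 1" "\<pi> 2 = 3" "\<pi> 3 = 2" | "\<pi> 1 = 2" "\<pi> 2 = 3" "\<pi> 3 = 1"
    | "\<pi> 1 = 3" "\<pi> 2 = 1" "\<pi> 3 = 2" | "\<pi> 1 = 3" "\<pi> 2 = 2" "\<pi> 3 = 1"
    using im inj by auto
  then show ?thesis
  proof cases
    case 1 then have "\<pi> = id" by (intro eqI) auto
    then show ?thesis by simp
  next
    case 2 then have "\<pi> = t" by (intro eqI) (auto simp: t_def transpose_def)
    then show ?thesis by simp
  next
    case 3 then have "\<pi> = u" by (intro eqI) (auto simp: u_def transpose_def)
    then show ?thesis by simp
  next
    case 4 then have "\<pi> = t \<circ> u" by (intro eqI) (auto simp: t_def u_def transpose_def)
    then show ?thesis by simp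
  next
    case 5 then have "\<pi> = u \<circ> t" by (intro eqI) (auto simp: t_def u_def transpose_def)
    then show ?thesis by simp
  next
    case 6 then have "\<pi> = t \<circ> u \<circ> t" by (intro eqI) (auto simp: t_def u_def transpose_def)
    then show ?thesis by simp
  qed
qed

lemma transpose_sq_eq_conjugate: "transpose_sq = conjugate_sq (transpose 1 2)"
  by (rule ext) (force simp: transpose_sq_def conjugate_sq_def transpose_def)

text \<open>\<open>T\<close> fixes \<open>M\<close>, and fixes \<open>K\<close> up to isotopy.
  Stripping \<open>T\<close> at either end of the six words leaves two cases: \<open>M\<close> is
  isotopic to \<open>K\<close> or to \<open>U K\<close>. The second is reduced to the first by the
  braid relation.\<close>

lemma paratopic_symmetric_imp_isotopic:
  assumes "(L, M) \<in> paratopic n" "symmetric_sq L" "symmetric_sq M"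
  shows "(L, M) \<in> isotopic n"
proof -
  \<comment> \<open>Isotopy without the Latin condition, so that it applies to intermediate
    conjugates directly.\<close>
  define sim where "sim = (\<lambda>K N. \<exists>i\<in>isotopisms n. N = i K)"
  define T where "T = conjugate_sq (transpose 1 2)"
  define U where "U = conjugate_sq (transpose 2 3)"
  have sim_sym: "sim N K" if "sim K N" for K N
    using that isotopisms_inv unfolding sim_def by (metis comp_apply id_apply)
  have sim_trans: "sim K P" if "sim K N" "sim N P" for K N P
    using that isotopisms_comp unfolding sim_def by (metis comp_apply)
  have cong: "sim (conjugate_sq \<pi> K) (conjugate_sq \<pi> N)"
    if "sim K N" "\<pi> permutes {1, 2, 3}" for \<pi> K N
    using that conjugate_isotopism_commute[OF that(2)] unfolding sim_def by (metis comp_apply)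
  have t: "transpose 1 2 permutes {1, 2, 3::nat}" and u: "transpose 2 3 permutes {1, 2, 3::nat}"
    by (auto intro: permutes_swap_id)
  have Tsim: "sim (T K) (T N)" and Usim: "sim (U K) (U N)" if "sim K N" for K N
    using cong that t u by (auto simp: T_def U_def)
  have TT: "T (T K) = K" and UU: "U (U K) = K" for K
    using conjugate_comp[OF t, of "transpose 1 2"] conjugate_comp[OF u, of "transpose 2 3"]
    by (auto simp: T_def U_def conjugate_id fun_eq_iff)
  have braid_perm: "transpose 2 3 \<circ> (transpose 1 2 \<circ> transpose 2 3) =
      transpose 1 2 \<circ> (transpose 2 3 \<circ> transpose 1 (2::nat))"
    by (auto simp: fun_eq_iff transpose_def)
  have "U \<circ> (T \<circ> U) = T \<circ> (U \<circ> T)"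
    unfolding T_def U_def conjugate_comp[OF t] conjugate_comp[OF u]
    by (simp only: comp_assoc braid_perm)
  then have braid: "U (T (U K)) = T (U (T K))" for K by (simp add: fun_eq_iff)
  obtain \<pi> i where \<pi>: "\<pi> permutes {1, 2, 3}" and i: "i \<in> isotopisms n"
      and M: "M = conjugate_sq \<pi> (i L)"
    using assms(1) by (auto simp: paratopic_alt paratopisms_def)
  define K where "K = i L"
  have LK: "sim L K" using i by (auto simp: sim_def K_def)
  have TL: "T L = L" and TM: "T M = M"
    using assms by (auto simp: symmetric_sq_def transpose_sq_eq_conjugate T_def)
  have "sim L (T K)" using Tsim[OF LK] TL by simp
  with sim_sym[OF LK] have KT: "sim K (T K)" by (rule sim_trans)
  have refl: "sim N N" for N unfolding sim_def by (rule bexI[OF _ isotopisms_id]) simp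
  \<comment> \<open>As \<open>T\<close> fixes \<open>M\<close>, it fixes \<open>U K\<close> up to
    isotopy. Applying \<open>U\<close> and the braid relation turns this into \<open>T U T K\<close>
    being isotopic to \<open>K\<close>; since \<open>T K\<close> is isotopic to \<open>K\<close>, so
    is \<open>T U K\<close>, which is also isotopic to \<open>M\<close>.\<close>
  have *: "sim K M" if "sim (U K) M"
  proof -
    have "sim (T (U K)) M" using Tsim[OF that] TM by simp
    then have "sim (T (U K)) (U K)" using that sim_sym sim_trans by blast
    from Usim[OF this] have "sim (T (U (T K))) K" by (simp add: UU braid)
    moreover have "sim (T (U K)) (T (U (T K)))" using KT Tsim Usim by blast
    ultimately have "sim (T (U K)) K" using sim_trans by blast
    with \<open>sim (T (U K)) M\<close> show ?thesis using sim_sym sim_trans by blast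
  qed
  \<comment> \<open>\<open>conjugate_sq\<close> reverses composition, so each word is read
    backwards.\<close>
  have words: "conjugate_sq (transpose 1 2 \<circ> transpose 2 3) = U \<circ> T"
      "conjugate_sq (transpose 2 3 \<circ> transpose 1 2) = T \<circ> U"
      "conjugate_sq (transpose 1 2 \<circ> transpose 2 3 \<circ> transpose 1 2) = T \<circ> (U \<circ> T)"
    by (simp_all only: T_def U_def conjugate_comp[OF t] conjugate_comp[OF u])
  have conj_K: "M \<in> {K, T K, U K, U (T K), T (U K), T (U (T K))}"
    using permutes_3_cases[OF \<pi>] unfolding M K_def[symmetric]
    by (elim insertE emptyE)
      (simp_all only: words conjugate_id T_def[symmetric] U_def[symmetric] comp_apply id_apply
        insert_iff simp_thms)
  consider "M = K" | "M = T K" | "M = U K" | "M = U (T K)" | "M = T (U K)" | "M = T (U (T K))"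
    using conj_K by blast
  then have "sim K M"
  proof cases
    case 1 then show ?thesis using refl by simp
  next
    case 2 then show ?thesis using KT by simp
  next
    case 3 then show ?thesis using * refl by simp
  next
    case 4 then show ?thesis using * Usim KT by blast
  next
    case 5
    then have "M = U K" using TM TT by metis
    then show ?thesis using * refl by simp
  next
    case 6
    then have "M = U (T K)" using TM TT by metis
    then show ?thesis using * Usim KT by blast
  qed
  then have "sim L M" using LK sim_trans by blast
  with assms(1) show ?thesis by (auto simp: paratopic_alt isotopic_alt sim_def)
qed

section \<open>Latin squares\<close>

lemma card_agree_le_1_iff:
  "card {i \<in> {1, 2, 3}. coord (r, c, s) i = coord (r', c', s') i} \<le> 1 \<longleftrightarrow>
     \<not> (r = r' \<and> c = c') \<and> \<not> (r = r' \<and> s = s') \<and> \<not> (c = c' \<and> s = s')"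
proof -
  have "{i \<in> {1, 2, 3}. coord (r, c, s) i = coord (r', c', s') i} =
      (if r = r' then {1} else {}) \<union> (if c = c' then {2} else {}) \<union> (if s = s' then {3} else {})"
    by auto
  then show ?thesis by simp
qed

text \<open>When no two triples share a cell, projection to (row, column) is injective, so having
  \<open>n\<^sup>2\<close> triples amounts to filling every cell.\<close>

lemma latin_square_iff:
  "latin_square n L \<longleftrightarrow>
     L \<subseteq> {1..n} \<times> {1..n} \<times> {1..n} \<and>
     (\<forall>r\<in>{1..n}. \<forall>c\<in>{1..n}. \<exists>s. (r, c, s) \<in> L) \<and>
     (\<forall>r c s s'. (r, c, s) \<in> L \<longrightarrow> (r, c, s') \<in> L \<longrightarrow> s = s') \<and>
     (\<forall>r c c' s. (r, c, s) \<in> L \<longrightarrow> (r, c', s) \<in> L \<longrightarrow> c = c') \<and>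
     (\<forall>r r' c s. (r, c, s) \<in> L \<longrightarrow> (r', c, s) \<in> L \<longrightarrow> r = r')"
    (is "_ \<longleftrightarrow> ?sub \<and> ?ex \<and> ?S \<and> ?C \<and> ?R")
proof -
  have agree: "(\<forall>t\<in>L. \<forall>u\<in>L. t \<noteq> u \<longrightarrow> card {i \<in> {1, 2, 3}. coord t i = coord u i} \<le> 1)
      \<longleftrightarrow> ?S \<and> ?C \<and> ?R" (is "?A \<longleftrightarrow> _")
  proof -
    have "?A \<longleftrightarrow> (\<forall>r c s r' c' s'. (r, c, s) \<in> L \<longrightarrow> (r', c', s') \<in> L \<longrightarrow> (r, c, s) \<noteq> (r', c', s') \<longrightarrow>
        card {i \<in> {1, 2, 3}. coord (r, c, s) i = coord (r', c', s') i} \<le> 1)"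
      by (simp only: Ball_def split_paired_All) blast
    also have "\<dots> \<longleftrightarrow> ?S \<and> ?C \<and> ?R"
      unfolding card_agree_le_1_iff by blast
    finally show ?thesis .
  qed
  define p where "p = (\<lambda>t :: triple. (fst t, fst (snd t)))"
  have "card L = n\<^sup>2 \<longleftrightarrow> ?ex" if ?sub ?S
  proof -
    have "inj_on p L" using that(2) by (auto simp: inj_on_def p_def)
    then have card: "card L = card (p ` L)" by (simp add: card_image)
    have sub: "p ` L \<subseteq> {1..n} \<times> {1..n}" using that(1) by (auto simp: p_def)
    have "card L = n\<^sup>2 \<longleftrightarrow> p ` L = {1..n} \<times> {1..n}"
      using card_subset_eq[OF _ sub] card by (auto simp: power2_eq_square)
    also have "\<dots> \<longleftrightarrow> {1..n} \<times> {1..n} \<subseteq> p ` L" using sub by blast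
    also have "\<dots> \<longleftrightarrow> ?ex"
    proof
      assume "{1..n} \<times> {1..n} \<subseteq> p ` L"
      then show ?ex by (force simp: p_def)
    next
      assume ex: ?ex
      show "{1..n} \<times> {1..n} \<subseteq> p ` L"
      proof clarify
        fix r c assume "r \<in> {1..n}" "c \<in> {1..n}"
        with ex obtain s where "(r, c, s) \<in> L" by blast
        then show "(r, c) \<in> p ` L" by (force simp: p_def)
      qed
    qed
    finally show ?thesis .
  qed
  then show ?thesis unfolding latin_square_def agree by blast
qed

lemma latin_square_range:
  assumes "latin_square n L" "(r, c, s) \<in> L"
  shows "r \<in> {1..n}" "c \<in> {1..n}" "s \<in> {1..n}"
  using assms unfolding latin_square_iff by blast+

lemma latin_square_ex_symbol:
  assumes "latin_square n L" "r \<in> {1..n}" "c \<in> {1..n}"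
  obtains s where "(r, c, s) \<in> L"
  using assms unfolding latin_square_iff by blast

lemma latin_square_symbol_eq:
  assumes "latin_square n L" "(r, c, s) \<in> L" "(r, c, s') \<in> L"
  shows "s = s'"
  using assms unfolding latin_square_iff by blast

lemma latin_square_col_eq:
  assumes "latin_square n L" "(r, c, s) \<in> L" "(r, c', s) \<in> L"
  shows "c = c'"
  using assms unfolding latin_square_iff by blast

lemma latin_square_row_eq:
  assumes "latin_square n L" "(r, c, s) \<in> L" "(r', c, s) \<in> L"
  shows "r = r'"
  using assms unfolding latin_square_iff by blast

text \<open>Both squares have the same finite size. This lets the later equalities of squares be
  proved by one inclusion.\<close>

lemma latin_square_subset_eq:
  assumes "latin_square n L" "latin_square n M" "L \<subseteq> M"
  shows "L = M"
proof (rule card_subset_eq[OF _ assms(3)])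
  show "finite M" using assms(2) by (auto simp: latin_square_def intro: finite_subset)
  show "card L = card M" using assms by (simp add: latin_square_def)
qed

text \<open>Row \<open>r\<close> is an injective map from columns to symbols, hence surjective on
  the finite set \<open>{1..n}\<close>.\<close>

lemma latin_square_ex_col:
  assumes "latin_square n L" "r \<in> {1..n}" "s \<in> {1..n}"
  obtains c where "(r, c, s) \<in> L"
proof -
  define f where "f = (\<lambda>c. SOME s. (r, c, s) \<in> L)"
  have f: "(r, c, f c) \<in> L" if "c \<in> {1..n}" for c
    using latin_square_ex_symbol[OF assms(1,2) that] unfolding f_def by (metis someI)
  have "f ` {1..n} \<subseteq> {1..n}" using f latin_square_range[OF assms(1)] by blast
  moreover have "inj_on f {1..n}"
    by (rule inj_onI) (metis f latin_square_col_eq[OF assms(1)])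
  ultimately have "f ` {1..n} = {1..n}" by (simp add: endo_inj_surj)
  with assms(3) obtain c where "c \<in> {1..n}" "s = f c" by blast
  with f that show ?thesis by blast
qed

lemma latin_square_isotope:
  assumes "latin_square n L" "\<alpha> permutes {1..n}" "\<beta> permutes {1..n}" "\<gamma> permutes {1..n}"
  shows "latin_square n (isotope \<alpha> \<beta> \<gamma> L)"
proof -
  have mem: "(inv \<alpha> r, inv \<beta> c, inv \<gamma> s) \<in> L" if "(r, c, s) \<in> isotope \<alpha> \<beta> \<gamma> L" for r c s
    using isotope_mem_inv[OF assms(2-4) that] .
  have inj: "inv \<alpha> x = inv \<alpha> y \<longleftrightarrow> x = y" "inv \<beta> x = inv \<beta> y \<longleftrightarrow> x = y" "inv \<gamma> x = inv \<gamma> y \<longleftrightarrow> x = y" for x y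
    using assms(2-4) by (metis permutes_inverses(1))+
  show ?thesis
    unfolding latin_square_iff
  proof (intro conjI ballI allI impI)
    show "isotope \<alpha> \<beta> \<gamma> L \<subseteq> {1..n} \<times> {1..n} \<times> {1..n}"
      using latin_square_range[OF assms(1)] assms(2-4)
      unfolding isotope_def by (auto simp del: atLeastAtMost_iff simp: permutes_in_image)
    fix r c assume rc: "r \<in> {1..n}" "c \<in> {1..n}"
    have "inv \<alpha> r \<in> {1..n}" "inv \<beta> c \<in> {1..n}"
      using rc assms permutes_inv permutes_in_image by metis+
    then obtain s where "(inv \<alpha> r, inv \<beta> c, s) \<in> L"
      using latin_square_ex_symbol[OF assms(1)] by blast
    from isotope_mem[OF this, of \<alpha> \<beta> \<gamma>] show "\<exists>s. (r, c, s) \<in> isotope \<alpha> \<beta> \<gamma> L"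
      using assms by (auto simp: permutes_inverses)
  next
    show "s = s'" if "(r, c, s) \<in> isotope \<alpha> \<beta> \<gamma> L" "(r, c, s') \<in> isotope \<alpha> \<beta> \<gamma> L" for r c s s'
      using latin_square_symbol_eq[OF assms(1) that[THEN mem]] by (simp add: inj)
    show "c = c'" if "(r, c, s) \<in> isotope \<alpha> \<beta> \<gamma> L" "(r, c', s) \<in> isotope \<alpha> \<beta> \<gamma> L" for r c c' s
      using latin_square_col_eq[OF assms(1) that[THEN mem]] by (simp add: inj)
    show "r = r'" if "(r, c, s) \<in> isotope \<alpha> \<beta> \<gamma> L" "(r', c, s) \<in> isotope \<alpha> \<beta> \<gamma> L" for r r' c s
      using latin_square_row_eq[OF assms(1) that[THEN mem]] by (simp add: inj)
  qed
qed

lemma symmetric_sq_iff: "symmetric_sq L \<longleftrightarrow> (\<forall>r c s. (r, c, s) \<in> L \<longrightarrow> (c, r, s) \<in> L)"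
proof
  assume "symmetric_sq L"
  then show "\<forall>r c s. (r, c, s) \<in> L \<longrightarrow> (c, r, s) \<in> L"
    unfolding symmetric_sq_def transpose_sq_def by force
next
  assume "\<forall>r c s. (r, c, s) \<in> L \<longrightarrow> (c, r, s) \<in> L"
  then show "symmetric_sq L"
    unfolding symmetric_sq_def transpose_sq_def by force
qed

section \<open>Symmetric squares of odd order\<close>

text \<open>The involution pairs off the elements; the linear order separates each pair into a
  smaller and a larger one, giving two halves of equal size.\<close>

lemma even_card_involution:
  fixes f :: "'a::linorder \<Rightarrow> 'a"
  assumes "finite A" "\<And>x. x \<in> A \<Longrightarrow> f x \<in> A" "\<And>x. x \<in> A \<Longrightarrow> f (f x) = x"
    and "\<And>x. x \<in> A \<Longrightarrow> f x \<noteq> x"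
  shows "even (card A)"
proof -
  let ?B = "{x \<in> A. x < f x}" and ?C = "{x \<in> A. f x < x}"
  have "bij_betw f ?B ?C"
    by (rule bij_betw_byWitness[of _ f]) (use assms in auto)
  then have "card ?B = card ?C" by (rule bij_betw_same_card)
  moreover have "A = ?B \<union> ?C" using assms(4) by force
  then have "card A = card ?B + card ?C"
    using assms(1) card_Un_disjoint[of ?B ?C] by fastforce
  ultimately show ?thesis by simp
qed

text \<open>If \<open>s\<close> missed the diagonal, sending each row to the column where it
  contains \<open>s\<close> would be, by symmetry, a fixed-point-free involution of a set of odd
  size.\<close>

lemma symmetric_odd_symbol_on_diagonal:
  assumes "latin_square n L" "symmetric_sq L" "odd n" "s \<in> {1..n}"
  obtains i where "(i, i, s) \<in> L"
proof (rule ccontr)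
  assume "\<not> thesis"
  with that have nd: "(i, i, s) \<notin> L" for i by blast
  define f where "f = (\<lambda>r. SOME c. (r, c, s) \<in> L)"
  have f: "(r, f r, s) \<in> L" if "r \<in> {1..n}" for r
    using latin_square_ex_col[OF assms(1) that assms(4)] unfolding f_def by (metis someI)
  have "even (card {1..n})"
  proof (rule even_card_involution[of _ f])
    fix r assume r: "r \<in> {1..n}"
    show fr: "f r \<in> {1..n}" using latin_square_range[OF assms(1) f[OF r]] by blast
    have "(f r, r, s) \<in> L" using f[OF r] assms(2) by (auto simp: symmetric_sq_iff)
    then show "f (f r) = r" using f[OF fr] latin_square_col_eq[OF assms(1)] by blast
    show "f r \<noteq> r" using f[OF r] nd by metis
  qed simp
  with assms(3) show False by simp
qed

lemma symmetric_odd_relabel_idempotent: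
  assumes "latin_square n L" "symmetric_sq L" "odd n"
  obtains \<gamma> where "\<gamma> permutes {1..n}" "idempotent_sq n (isotope id id \<gamma> L)"
    "symmetric_sq (isotope id id \<gamma> L)"
proof -
  \<comment> \<open>\<open>g\<close> renames each symbol to a diagonal position where it occurs, and
    is the identity elsewhere as \<open>permutes\<close> demands. It is injective because a diagonal
    cell holds one symbol.\<close>
  define g where "g = (\<lambda>s. if s \<in> {1..n} then SOME i. (i, i, s) \<in> L else s)"
  have g: "(g s, g s, s) \<in> L" if s: "s \<in> {1..n}" for s
  proof -
    obtain i where "(i, i, s) \<in> L" using symmetric_odd_symbol_on_diagonal[OF assms s] .
    from someI[of "\<lambda>i. (i, i, s) \<in> L", OF this] show ?thesis
      using s by (simp add: g_def)
  qed
  have "g ` {1..n} \<subseteq> {1..n}" using g latin_square_range[OF assms(1)] by blast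
  moreover have inj: "inj_on g {1..n}"
    by (rule inj_onI) (metis g latin_square_symbol_eq[OF assms(1)])
  ultimately have im: "g ` {1..n} = {1..n}" by (simp add: endo_inj_surj)
  have "g permutes {1..n}"
    by (rule bij_imp_permutes) (use im inj in \<open>auto simp: bij_betw_def g_def\<close>)
  moreover have "idempotent_sq n (isotope id id g L)"
    unfolding idempotent_sq_def
  proof
    fix i assume "i \<in> {1..n}"
    with im obtain s where "s \<in> {1..n}" "i = g s" by blast
    with isotope_mem[OF g, of s id id g] show "(i, i, i) \<in> isotope id id g L" by simp
  qed
  moreover have "symmetric_sq (isotope id id g L)"
    using assms(2) unfolding symmetric_sq_iff isotope_def by force
  ultimately show ?thesis using that by blast
qed

lemma idempotent_imp_diagonal:
  assumes "latin_square n L" "idempotent_sq n L"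
  shows "diagonal_sq L"
proof -
  have "s = i" if "(i, i, s) \<in> L" for i s
    using that assms latin_square_range[OF assms(1) that] latin_square_symbol_eq[OF assms(1)]
    unfolding idempotent_sq_def by blast
  then show ?thesis unfolding diagonal_sq_def by blast
qed

section \<open>Isotopic idempotent symmetric squares are isomorphic\<close>

text \<open>If the order \<open>m\<close> of \<open>p\<close> were even, its half power would square
  to the identity, hence be trivial, contradicting minimality. So \<open>m\<close> is odd and the
  exponent \<open>(m + 1) / 2\<close> gives a root.\<close>

lemma permutation_square_root:
  assumes "p permutes S" "finite S"
    and no_involution: "\<And>k. (p ^^ k) \<circ> (p ^^ k) = id \<Longrightarrow> p ^^ k = id"
  obtains k where "(p ^^ k) \<circ> (p ^^ k) = p"
proof -
  have "permutation p" using assms by (auto simp: permutation_permutes)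
  then obtain m0 where "p ^^ m0 = id" "m0 > 0" by (rule permutation_is_nilpotent)
  then have ex: "\<exists>m. p ^^ m = id \<and> m > 0" by blast
  define m where "m = (LEAST m. p ^^ m = id \<and> m > 0)"
  have m: "p ^^ m = id" "m > 0" using LeastI_ex[OF ex] by (auto simp: m_def)
  have least: "m \<le> k" if "p ^^ k = id" "k > 0" for k
    unfolding m_def using that by (intro Least_le) auto
  have "odd m"
  proof
    assume "even m"
    then obtain k where k: "m = k + k" by (metis evenE mult_2)
    then have "p ^^ k = id" using m no_involution by (simp add: funpow_add)
    with least[of k] k m show False by simp
  qed
  then obtain k where "Suc m = k + k" by (metis even_Suc evenE mult_2)
  then have "(p ^^ k) \<circ> (p ^^ k) = p ^^ Suc m" by (simp add: funpow_add)
  also have "\<dots> = p" using m by simp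
  finally show ?thesis by (rule that)
qed

text \<open>Transposing \<open>L\<close>, applying the isotopism, transposing \<open>M\<close> and
  going back yields an autotopism of \<open>L\<close> that fixes symbols. A suitable power of it
  balances the difference between \<alpha> and \<beta> evenly over rows and columns.\<close>

lemma isotopic_symmetric_diagonal_imp_rrs:
  assumes L: "latin_square n L" "symmetric_sq L" "diagonal_sq L"
    and M: "latin_square n M" "symmetric_sq M"
    and perms: "\<alpha> permutes {1..n}" "\<beta> permutes {1..n}" "\<gamma> permutes {1..n}"
    and eq: "M = isotope \<alpha> \<beta> \<gamma> L"
  obtains \<delta> where "\<delta> permutes {1..n}" "M = isotope \<delta> \<delta> \<gamma> L"
proof -
  define \<theta> where "\<theta> = inv \<alpha> \<circ> \<beta>"
  have \<theta>: "\<theta> permutes {1..n}"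
    unfolding \<theta>_def using perms by (intro permutes_compose permutes_inv)
  have inv\<theta>: "inv \<theta> = inv \<beta> \<circ> \<alpha>"
    unfolding \<theta>_def
    using o_inv_distrib[OF permutes_bij[OF permutes_inv[OF perms(1)]] permutes_bij[OF perms(2)]]
    by (simp add: permutes_inv_inv[OF perms(1)])
  have step: "(\<theta> r, inv \<theta> c, s) \<in> L" if "(r, c, s) \<in> L" for r c s
  proof -
    have "(c, r, s) \<in> L" using that L by (simp add: symmetric_sq_iff)
    then have "(\<alpha> c, \<beta> r, \<gamma> s) \<in> M" unfolding eq by (rule isotope_mem)
    then have "(\<beta> r, \<alpha> c, \<gamma> s) \<in> M" using M by (simp add: symmetric_sq_iff)
    from isotope_mem_inv[OF perms this[unfolded eq]] show ?thesis
      unfolding inv\<theta> by (simp add: \<theta>_def permutes_inverses[OF perms(3)])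
  qed
  have pow: "((\<theta> ^^ k) r, (inv \<theta> ^^ k) c, s) \<in> L" if "(r, c, s) \<in> L" for r c s k
    by (induction k) (use that step in auto)
  have inv_pow: "(\<theta> ^^ k) ((inv \<theta> ^^ k) x) = x" for k x
    using fn_o_inv_fn_is_id[OF permutes_bij[OF \<theta>], of k] by (simp add: fun_eq_iff)
  obtain k where k: "(\<theta> ^^ k) \<circ> (\<theta> ^^ k) = \<theta>"
  proof (rule permutation_square_root[OF \<theta>])
    fix k assume inv: "(\<theta> ^^ k) \<circ> (\<theta> ^^ k) = id"
    \<comment> \<open>A power squaring to the identity is its own inverse, so the autotopism moves
      the diagonal cell of \<open>x\<close> to a diagonal cell with the same symbol; distinct
      diagonal symbols make it the same cell.\<close>
    have same: "(inv \<theta> ^^ k) x = (\<theta> ^^ k) x" for x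
      using inv_pow[of k x] inv by (metis comp_apply id_apply)
    have perm: "(\<theta> ^^ k) permutes {1..n}" using \<theta> by (rule permutes_funpow)
    show "\<theta> ^^ k = id"
    proof
      fix x
      show "(\<theta> ^^ k) x = id x"
      proof (cases "x \<in> {1..n}")
        case True
        then obtain s where s: "(x, x, s) \<in> L" using latin_square_ex_symbol[OF L(1)] by blast
        from pow[OF s, of k] have "((\<theta> ^^ k) x, (\<theta> ^^ k) x, s) \<in> L" by (simp add: same)
        with s L(3) show ?thesis unfolding diagonal_sq_def by auto
      next
        case False
        then show ?thesis using permutes_not_in[OF perm] by simp
      qed
    qed
  qed auto
  define \<delta> where "\<delta> = \<alpha> \<circ> (\<theta> ^^ k)"
  have \<delta>: "\<delta> permutes {1..n}"
    unfolding \<delta>_def using \<theta> perms by (intro permutes_compose permutes_funpow)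
  \<comment> \<open>Here \<open>\<beta> = \<alpha> \<circ> \<theta>\<close>, with \<theta> split as
    a square. After the autotopism \<open>(\<theta> ^^ k, inv \<theta> ^^ k, id)\<close> one factor
    cancels in the columns, leaving \<delta> on both sides.\<close>
  have \<beta>: "\<beta> x = \<alpha> ((\<theta> ^^ k) ((\<theta> ^^ k) x))" for x
    using fun_cong[OF k, of x] perms by (simp add: \<theta>_def permutes_inverses)
  have "isotope \<delta> \<delta> \<gamma> L \<subseteq> M"
  proof
    fix t assume "t \<in> isotope \<delta> \<delta> \<gamma> L"
    then obtain r c s where t: "t = (\<delta> r, \<delta> c, \<gamma> s)" "(r, c, s) \<in> L"
      by (auto simp: isotope_def)
    from isotope_mem[OF pow[OF t(2), of k], of \<alpha> \<beta> \<gamma>] show "t \<in> M"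
      by (simp add: t eq \<delta>_def \<beta> inv_pow)
  qed
  then have "M = isotope \<delta> \<delta> \<gamma> L"
    using latin_square_subset_eq[OF latin_square_isotope[OF L(1) \<delta> \<delta> perms(3)] M(1)] by simp
  with \<delta> show ?thesis by (rule that)
qed

text \<open>Once rows and columns move by the same \<delta>, the diagonal cell of \<open>M\<close>
  at \<open>\<delta> x\<close> holds \<open>\<gamma> x\<close> by idempotency of \<open>L\<close>
  and \<open>\<delta> x\<close> by idempotency of \<open>M\<close>.\<close>

lemma isotopic_idempotent_symmetric_imp_isomorphic:
  assumes "(L, M) \<in> isotopic n" "idempotent_sq n L" "symmetric_sq L"
    "idempotent_sq n M" "symmetric_sq M"
  shows "(L, M) \<in> isomorphic n"
proof -
  have L: "latin_square n L" and M: "latin_square n M"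
    using assms(1) by (auto simp: isotopic_def latin_squares_def)
  obtain \<alpha> \<beta> \<gamma> where perms: "\<alpha> permutes {1..n}" "\<beta> permutes {1..n}" "\<gamma> permutes {1..n}"
      and eq: "M = isotope \<alpha> \<beta> \<gamma> L"
    using assms(1) by (auto simp: isotopic_def)
  obtain \<delta> where \<delta>: "\<delta> permutes {1..n}" "M = isotope \<delta> \<delta> \<gamma> L"
    using isotopic_symmetric_diagonal_imp_rrs[OF L assms(3) idempotent_imp_diagonal[OF L assms(2)]
        M assms(5) perms eq] .
  have "\<gamma> = \<delta>"
  proof
    fix x
    show "\<gamma> x = \<delta> x"
    proof (cases "x \<in> {1..n}")
      case True
      then have "(\<delta> x, \<delta> x, \<gamma> x) \<in> M"
        using assms(2) isotope_mem[of x x x L] by (simp add: \<delta>(2) idempotent_sq_def)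
      moreover have "(\<delta> x, \<delta> x, \<delta> x) \<in> M"
        using True assms(4) permutes_in_image[OF \<delta>(1)] unfolding idempotent_sq_def by blast
      ultimately show ?thesis by (rule latin_square_symbol_eq[OF M])
    next
      case False
      then show ?thesis using permutes_not_in perms \<delta>(1) by metis
    qed
  qed
  with \<delta> L M show ?thesis by (auto simp: isomorphic_def latin_squares_def)
qed

section \<open>Prolongation to order \<open>n + 1\<close>\<close>

text \<open>All old indices shift up by one, so that the new row, column and symbol are 1. Each
  displaced diagonal symbol goes to the border, and the diagonal receives 1.\<close>

definition prolong :: "nat \<Rightarrow> triple set \<Rightarrow> triple set" where
  "prolong n L =
     (\<lambda>i. (1, i, i)) ` {1..n + 1} \<union> (\<lambda>i. (i, 1, i)) ` {1..n + 1} \<union> (\<lambda>i. (i, i, 1)) ` {1..n + 1} \<union>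
     {(Suc r, Suc c, Suc s) | r c s. (r, c, s) \<in> L \<and> r \<noteq> c}"

text \<open>The lower bounds discard triples of \<open>N\<close> involving index 1, which would
  shift down to 0.\<close>

definition unprolong :: "nat \<Rightarrow> triple set \<Rightarrow> triple set" where
  "unprolong n N =
     (\<lambda>i. (i, i, i)) ` {1..n} \<union>
     {(r, c, s) | r c s. 1 \<le> r \<and> 1 \<le> c \<and> 1 \<le> s \<and> r \<noteq> c \<and> (Suc r, Suc c, Suc s) \<in> N}"

text \<open>The symbol \<open>r\<close> already occurs in row \<open>r\<close>, and \<open>c\<close>
  in column \<open>c\<close>, on the diagonal. This keeps the border of \<open>prolong\<close> from
  repeating interior symbols.\<close>

lemma idempotent_off_diagonal:
  assumes "latin_square n L" "idempotent_sq n L" "(r, c, s) \<in> L" "r \<noteq> c"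
  shows "s \<noteq> r" "s \<noteq> c"
proof -
  have "(r, r, r) \<in> L" "(c, c, c) \<in> L"
    using assms(2) latin_square_range[OF assms(1,3)] by (auto simp: idempotent_sq_def)
  with assms show "s \<noteq> r" "s \<noteq> c"
    using latin_square_col_eq[OF assms(1)] latin_square_row_eq[OF assms(1)] by blast+
qed

lemma prolong_mem_iff:
  "(x, y, z) \<in> prolong n L \<longleftrightarrow>
     x = 1 \<and> y = z \<and> y \<in> {1..n + 1} \<or> y = 1 \<and> x = z \<and> x \<in> {1..n + 1} \<or>
     z = 1 \<and> x = y \<and> x \<in> {1..n + 1} \<or>
     (\<exists>r c s. x = Suc r \<and> y = Suc c \<and> z = Suc s \<and> (r, c, s) \<in> L \<and> r \<noteq> c)"
  unfolding prolong_def by auto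

lemma latin_square_prolong:
  assumes "latin_square n L" "idempotent_sq n L"
  shows "latin_square (n + 1) (prolong n L)"
proof -
  note range = latin_square_range[OF assms(1)]
  note off = idempotent_off_diagonal[OF assms]
  \<comment> \<open>Shifted entries are therefore at least 2 and never collide with the new index
    1.\<close>
  have range0: "r \<noteq> 0" "c \<noteq> 0" "s \<noteq> 0" if "(r, c, s) \<in> L" for r c s
    using range[OF that] by auto
  show ?thesis
    unfolding latin_square_iff
  proof (intro conjI ballI allI impI)
    show "prolong n L \<subseteq> {1..n + 1} \<times> {1..n + 1} \<times> {1..n + 1}"
      using range by (fastforce simp: prolong_def)
  next
    fix x y assume xy: "x \<in> {1..n + 1}" "y \<in> {1..n + 1}"
    show "\<exists>z. (x, y, z) \<in> prolong n L"
    proof (cases "x = 1 \<or> y = 1 \<or> x = y")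
      case True
      with xy show ?thesis by (auto simp: prolong_mem_iff)
    next
      case False
      define r c where "r = x - 1" and "c = y - 1"
      have "x = Suc r" "y = Suc c" "r \<in> {1..n}" "c \<in> {1..n}" "r \<noteq> c"
        using xy False by (auto simp: r_def c_def)
      moreover then obtain s where "(r, c, s) \<in> L"
        using latin_square_ex_symbol[OF assms(1)] by blast
      ultimately show ?thesis by (auto simp: prolong_mem_iff)
    qed
  next
    fix x y z z' assume "(x, y, z) \<in> prolong n L" "(x, y, z') \<in> prolong n L"
    then show "z = z'"
      unfolding prolong_mem_iff
      by (auto dest: range0 off latin_square_symbol_eq[OF assms(1)])
  next
    fix x y y' z assume "(x, y, z) \<in> prolong n L" "(x, y', z) \<in> prolong n L"
    then show "y = y'"
      unfolding prolong_mem_iff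
      by (auto dest: range0 off latin_square_col_eq[OF assms(1)])
  next
    fix x x' y z assume "(x, y, z) \<in> prolong n L" "(x', y, z) \<in> prolong n L"
    then show "x = x'"
      unfolding prolong_mem_iff
      by (auto dest: range0 off latin_square_row_eq[OF assms(1)])
  qed
qed

lemma prolong_properties:
  assumes "symmetric_sq L"
  shows "unipotent_sq (prolong n L)" "symmetric_sq (prolong n L)" "reduced_sq (n + 1) (prolong n L)"
  using assms unfolding unipotent_sq_def symmetric_sq_iff reduced_sq_def prolong_mem_iff by auto

section \<open>Removing the border of a unipotent symmetric reduced square\<close>

context
  fixes n :: nat and N :: "triple set"
  assumes N: "latin_square (n + 1) N" "unipotent_sq N" "symmetric_sq N" "reduced_sq (n + 1) N"
begin

lemma unipotent_reduced_diagonal: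
  assumes "i \<in> {1..n + 1}"
  shows "(i, i, 1) \<in> N"
proof -
  obtain s where s: "(i, i, s) \<in> N" using latin_square_ex_symbol[OF N(1) assms assms] .
  have "(1, 1, 1) \<in> N" using N(4) by (auto simp: reduced_sq_def)
  with s N(2) have "s = 1" unfolding unipotent_sq_def by blast
  with s show ?thesis by simp
qed

text \<open>In row \<open>Suc r\<close> of \<open>N\<close> the symbol \<open>Suc r\<close> sits in
  column 1 and the symbol 1 on the diagonal. The other cells, shifted down, thus use exactly the
  symbols other than \<open>r\<close>, leaving \<open>r\<close> for the diagonal cell; columns
  behave alike.\<close>

lemma latin_square_unprolong: "latin_square n (unprolong n N)"
proof -
  have mem: "(r, c, s) \<in> unprolong n N \<longleftrightarrow> r = c \<and> s = r \<and> r \<in> {1..n} \<or>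
      1 \<le> r \<and> 1 \<le> c \<and> 1 \<le> s \<and> r \<noteq> c \<and> (Suc r, Suc c, Suc s) \<in> N" for r c s
    unfolding unprolong_def by auto
  note range = latin_square_range[OF N(1)]
  have row1: "(1, Suc i, Suc i) \<in> N" "(Suc i, 1, Suc i) \<in> N" if "1 \<le> i" "i \<le> n" for i
    using N(4) that by (auto simp: reduced_sq_def)
  have off: "s \<noteq> r" "s \<noteq> c" if "(Suc r, Suc c, Suc s) \<in> N" "1 \<le> r" "1 \<le> c" for r c s
    using range[OF that(1)] that row1[of r] row1[of c]
      latin_square_col_eq[OF N(1), of "Suc r" "Suc c" "Suc r" 1]
      latin_square_row_eq[OF N(1), of "Suc r" "Suc c" "Suc c" 1] by auto
  show ?thesis
    unfolding latin_square_iff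
  proof (intro conjI ballI allI impI)
    show "unprolong n N \<subseteq> {1..n} \<times> {1..n} \<times> {1..n}"
      using range by (fastforce simp: unprolong_def)
  next
    fix r c assume rc: "r \<in> {1..n}" "c \<in> {1..n}"
    show "\<exists>s. (r, c, s) \<in> unprolong n N"
    proof (cases "r = c")
      case True
      with rc show ?thesis by (auto simp: mem)
    next
      case False
      have "Suc r \<in> {1..n + 1}" "Suc c \<in> {1..n + 1}" using rc by auto
      then obtain z where z: "(Suc r, Suc c, z) \<in> N"
        using latin_square_ex_symbol[OF N(1)] by blast
      \<comment> \<open>The symbol 1 of this row stands on the diagonal, so \<open>z\<close> can be
        shifted down.\<close>
      have "z \<noteq> 1"
        using z unipotent_reduced_diagonal[of "Suc r"] rc False
          latin_square_col_eq[OF N(1), of "Suc r" "Suc c" 1 "Suc r"] by auto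
      with range[OF z] have "z = Suc (z - 1)" "1 \<le> z - 1" by auto
      with z rc False show ?thesis unfolding mem by (metis atLeastAtMost_iff)
    qed
  next
    fix r c s s' assume "(r, c, s) \<in> unprolong n N" "(r, c, s') \<in> unprolong n N"
    then show "s = s'"
      unfolding mem by (auto dest: latin_square_symbol_eq[OF N(1)])
  next
    fix r c c' s assume "(r, c, s) \<in> unprolong n N" "(r, c', s) \<in> unprolong n N"
    then show "c = c'"
      unfolding mem by (auto dest: latin_square_col_eq[OF N(1)] off)
  next
    fix r r' c s assume "(r, c, s) \<in> unprolong n N" "(r', c, s) \<in> unprolong n N"
    then show "r = r'"
      unfolding mem by (auto dest: latin_square_row_eq[OF N(1)] off)
  qed
qed

lemma unprolong_idempotent: "idempotent_sq n (unprolong n N)"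
  by (auto simp: idempotent_sq_def unprolong_def)

lemma unprolong_symmetric: "symmetric_sq (unprolong n N)"
  using N(3) unfolding symmetric_sq_iff unprolong_def by auto

text \<open>Both sides are Latin squares, so one inclusion suffices: the border lies in
  \<open>N\<close> by reducedness and the diagonal by unipotency.\<close>

lemma prolong_unprolong: "prolong n (unprolong n N) = N"
proof (rule latin_square_subset_eq[OF latin_square_prolong[OF latin_square_unprolong unprolong_idempotent] N(1)])
  show "prolong n (unprolong n N) \<subseteq> N"
    using N(4) unipotent_reduced_diagonal
    unfolding prolong_def unprolong_def reduced_sq_def by auto
qed

end

text \<open>Shifting by one matches permutations of \<open>{1..n}\<close> with the permutations of
  \<open>{1..n + 1}\<close> that fix 1.\<close>

lemma isomorphic_prolong_iff:
  assumes L: "latin_square n L" "idempotent_sq n L" and M: "latin_square n M" "idempotent_sq n M"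
  shows "(L, M) \<in> isomorphic n \<longleftrightarrow> (prolong n L, prolong n M) \<in> isomorphic (n + 1)"
proof
  assume "(L, M) \<in> isomorphic n"
  then obtain \<alpha> where \<alpha>: "\<alpha> permutes {1..n}" "M = isotope \<alpha> \<alpha> \<alpha> L"
    by (auto simp: isomorphic_def)
  \<comment> \<open>The shift of \<alpha>. As \<alpha> fixes 0, which is outside
    \<open>{1..n}\<close>, \<delta> fixes 1; the first clause keeps 0 fixed too.\<close>
  define \<delta> where "\<delta> = (\<lambda>x. case x of 0 \<Rightarrow> 0 | Suc y \<Rightarrow> Suc (\<alpha> y))"
  have \<alpha>0: "\<alpha> 0 = 0" using permutes_not_in[OF \<alpha>(1)] by auto
  have \<delta>_simps: "\<delta> 0 = 0" "\<delta> (Suc y) = Suc (\<alpha> y)" for y by (auto simp: \<delta>_def)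
  have inj: "\<alpha> x = \<alpha> y \<longleftrightarrow> x = y" for x y using permutes_inj[OF \<alpha>(1)] by (simp add: inj_eq)
  have \<delta>: "\<delta> permutes {1..n + 1}"
  proof (rule bij_imp_permutes)
    have "inj_on \<delta> {1..n + 1}"
      by (rule inj_onI) (auto simp: \<delta>_def inj split: nat.splits)
    moreover have "\<delta> ` {1..n + 1} \<subseteq> {1..n + 1}"
    proof clarify
      fix x assume "x \<in> {1..n + 1}"
      then obtain y where y: "x = Suc y" "y \<le> n" by (cases x) auto
      have "\<alpha> y \<le> n"
        using permutes_in_image[OF \<alpha>(1), of y] y \<alpha>0 by (cases "y = 0") auto
      then show "\<delta> x \<in> {1..n + 1}" by (simp add: y \<delta>_simps)
    qed
    ultimately show "bij_betw \<delta> {1..n + 1} {1..n + 1}"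
      by (simp add: bij_betw_def endo_inj_surj)
    show "\<delta> x = x" if "x \<notin> {1..n + 1}" for x
      using that permutes_not_in[OF \<alpha>(1)] by (cases x) (auto simp: \<delta>_simps)
  qed
  have \<delta>1: "\<delta> 1 = 1" using \<alpha>0 by (simp add: \<delta>_simps)
  have "isotope \<delta> \<delta> \<delta> (prolong n L) \<subseteq> prolong n M"
  proof
    fix t assume "t \<in> isotope \<delta> \<delta> \<delta> (prolong n L)"
    then obtain x y z where t: "t = (\<delta> x, \<delta> y, \<delta> z)" "(x, y, z) \<in> prolong n L"
      by (auto simp: isotope_def)
    have range: "\<delta> i \<in> {1..n + 1} \<longleftrightarrow> i \<in> {1..n + 1}" for i
      using permutes_in_image[OF \<delta>] .
    from t(2) consider "x = 1" "y = z" "y \<in> {1..n + 1}" | "y = 1" "x = z" "x \<in> {1..n + 1}"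
      | "z = 1" "x = y" "x \<in> {1..n + 1}"
      | r c s where "x = Suc r" "y = Suc c" "z = Suc s" "(r, c, s) \<in> L" "r \<noteq> c"
      unfolding prolong_mem_iff by blast
    then show "t \<in> prolong n M"
    proof cases
      case 4
      then have "(\<alpha> r, \<alpha> c, \<alpha> s) \<in> M" using isotope_mem \<alpha>(2) by simp
      with 4 show ?thesis unfolding t prolong_mem_iff by (auto simp: \<delta>_simps inj)
    qed (use range \<delta>1 in \<open>simp_all add: t prolong_mem_iff del: atLeastAtMost_iff\<close>)
  qed
  then have "prolong n M = isotope \<delta> \<delta> \<delta> (prolong n L)"
    using latin_square_subset_eq latin_square_isotope[OF latin_square_prolong[OF L] \<delta> \<delta> \<delta>]
      latin_square_prolong[OF M] by metis
  with \<delta> latin_square_prolong[OF L] latin_square_prolong[OF M]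
  show "(prolong n L, prolong n M) \<in> isomorphic (n + 1)"
    unfolding isomorphic_def latin_squares_def by blast
next
  assume "(prolong n L, prolong n M) \<in> isomorphic (n + 1)"
  then obtain \<delta> where \<delta>: "\<delta> permutes {1..n + 1}" "prolong n M = isotope \<delta> \<delta> \<delta> (prolong n L)"
    by (auto simp: isomorphic_def)
  have inj: "\<delta> x = \<delta> y \<longleftrightarrow> x = y" for x y using permutes_inj[OF \<delta>(1)] by (simp add: inj_eq)
  have range: "\<delta> i \<in> {1..n + 1} \<longleftrightarrow> i \<in> {1..n + 1}" for i
    using permutes_in_image[OF \<delta>(1)] .
  \<comment> \<open>1 is the symbol on the diagonal of both prolongations, so \<open>\<delta>\<close> fixes it.\<close>
  have "(1, 1, 1) \<in> prolong n L" by (auto simp: prolong_mem_iff)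
  then have "(\<delta> 1, \<delta> 1, \<delta> 1) \<in> prolong n M" unfolding \<delta>(2) by (rule isotope_mem)
  then have \<delta>1: "\<delta> 1 = 1" by (auto simp: prolong_mem_iff)
  \<comment> \<open>The subtraction loses nothing: \<delta> is injective and fixes 0, so
    \<open>\<delta> (Suc y)\<close> is positive.\<close>
  define \<alpha> where "\<alpha> = (\<lambda>y. \<delta> (Suc y) - 1)"
  have \<delta>0: "\<delta> 0 = 0" using permutes_not_in[OF \<delta>(1)] by auto
  have \<delta>_Suc: "\<delta> (Suc y) = Suc (\<alpha> y)" for y
    using inj[of "Suc y" 0] \<delta>0 by (simp add: \<alpha>_def)
  have \<alpha>0: "\<alpha> 0 = 0" using \<delta>1 by (simp add: \<alpha>_def)
  have inj\<alpha>: "\<alpha> x = \<alpha> y \<longleftrightarrow> x = y" for x y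
    using inj[of "Suc x" "Suc y"] by (simp add: \<delta>_Suc)
  have \<alpha>: "\<alpha> permutes {1..n}"
  proof (rule bij_imp_permutes)
    have "\<alpha> ` {1..n} \<subseteq> {1..n}"
    proof clarify
      fix y assume "y \<in> {1..n}"
      then show "\<alpha> y \<in> {1..n}"
        using range[of "Suc y"] inj\<alpha>[of y 0] \<alpha>0 by (auto simp: \<delta>_Suc)
    qed
    moreover have "inj_on \<alpha> {1..n}" by (rule inj_onI) (simp add: inj\<alpha>)
    ultimately show "bij_betw \<alpha> {1..n} {1..n}"
      by (simp add: bij_betw_def endo_inj_surj)
    show "\<alpha> x = x" if "x \<notin> {1..n}" for x
    proof (cases "x = 0")
      case False
      then have "Suc x \<notin> {1..n + 1}" using that by auto
      then show ?thesis using permutes_not_in[OF \<delta>(1)] by (simp add: \<alpha>_def)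
    qed (simp add: \<alpha>0)
  qed
  have "isotope \<alpha> \<alpha> \<alpha> L \<subseteq> M"
  proof
    fix t assume "t \<in> isotope \<alpha> \<alpha> \<alpha> L"
    then obtain r c s where t: "t = (\<alpha> r, \<alpha> c, \<alpha> s)" "(r, c, s) \<in> L"
      by (auto simp: isotope_def)
    note rcs = latin_square_range[OF L(1) t(2)]
    show "t \<in> M"
    \<comment> \<open>Diagonal triples of \<open>L\<close> leave no shifted copy in the
      prolongation; idempotency of both squares handles them instead.\<close>
    proof (cases "r = c")
      case True
      have "(r, r, r) \<in> L" using rcs(1) L(2) by (auto simp: idempotent_sq_def)
      then have "s = r" using t(2) True latin_square_symbol_eq[OF L(1)] by blast
      moreover have "\<alpha> r \<in> {1..n}" using rcs(1) permutes_in_image[OF \<alpha>] by blast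
      ultimately show ?thesis using M(2) True by (auto simp: t idempotent_sq_def)
    next
      case False
      then have "(Suc r, Suc c, Suc s) \<in> prolong n L" using t by (auto simp: prolong_mem_iff)
      then have "(Suc (\<alpha> r), Suc (\<alpha> c), Suc (\<alpha> s)) \<in> prolong n M"
        unfolding \<delta>(2) \<delta>_Suc[symmetric] by (rule isotope_mem)
      moreover have "\<alpha> r \<noteq> 0" "\<alpha> c \<noteq> 0" "\<alpha> r \<noteq> \<alpha> c"
        using inj\<alpha>[of r 0] inj\<alpha>[of c 0] inj\<alpha>[of r c] rcs False \<alpha>0 by auto
      ultimately show ?thesis by (auto simp: t prolong_mem_iff)
    qed
  qed
  then have "M = isotope \<alpha> \<alpha> \<alpha> L"
    using latin_square_subset_eq[OF latin_square_isotope[OF L(1) \<alpha> \<alpha> \<alpha>] M(1)] by simp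
  with \<alpha> L M show "(L, M) \<in> isomorphic n"
    by (auto simp: isomorphic_def latin_squares_def)
qed

section \<open>Equality of the counts\<close>

lemma isomorphic_imp_rrs: "isomorphic n \<subseteq> rrs_isotopic n"
  unfolding isomorphic_def rrs_isotopic_def by blast

lemma rrs_imp_isotopic: "rrs_isotopic n \<subseteq> isotopic n"
  unfolding rrs_isotopic_def isotopic_def by blast

lemma isotopic_imp_paratopic: "isotopic n \<subseteq> paratopic n"
proof -
  have "isotopisms n \<subseteq> paratopisms n"
  proof
    fix i assume "i \<in> isotopisms n"
    moreover have "i = conjugate_sq id \<circ> i" by (simp add: conjugate_id)
    ultimately show "i \<in> paratopisms n"
      unfolding paratopisms_def using permutes_id by blast
  qed
  then show ?thesis unfolding isotopic_alt paratopic_alt by blast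
qed

text \<open>Relabelling symbols is an isotopism, so every species with a symmetric square already
  contains an idempotent symmetric one.\<close>

lemma paratopic_to_idempotent_symmetric:
  assumes "latin_square n L" "symmetric_sq L" "odd n"
  obtains K where "latin_square n K" "idempotent_sq n K" "symmetric_sq K" "(K, L) \<in> paratopic n"
proof -
  obtain \<gamma> where \<gamma>: "\<gamma> permutes {1..n}" "idempotent_sq n (isotope id id \<gamma> L)"
      "symmetric_sq (isotope id id \<gamma> L)"
    using symmetric_odd_relabel_idempotent[OF assms] .
  let ?K = "isotope id id \<gamma> L"
  have K: "latin_square n ?K"
    using assms(1) \<gamma>(1) by (intro latin_square_isotope permutes_id)
  have "(L, ?K) \<in> isotopic n"
    using assms(1) K \<gamma>(1) permutes_id unfolding isotopic_def latin_squares_def by blast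
  then have "(?K, L) \<in> paratopic n"
    using isotopic_imp_paratopic equiv_isotopic by (meson equivE subsetD symD)
  with \<gamma> K that show ?thesis by blast
qed

theorem theorem7:
  fixes n :: nat
  assumes "odd n"
  shows
    "card (classes_containing n (paratopic n) symmetric_sq) =
       card (classes_containing n (paratopic n) (\<lambda>L. diagonal_sq L \<and> symmetric_sq L))
   \<and> card (classes_containing n (paratopic n) (\<lambda>L. diagonal_sq L \<and> symmetric_sq L)) =
       card (classes_containing n (paratopic n) (\<lambda>L. idempotent_sq n L \<and> symmetric_sq L))
   \<and> card (classes_containing n (paratopic n) (\<lambda>L. idempotent_sq n L \<and> symmetric_sq L)) =
       card (classes_containing n (isotopic n) (\<lambda>L. idempotent_sq n L \<and> symmetric_sq L))
   \<and> card (classes_containing n (isotopic n) (\<lambda>L. idempotent_sq n L \<and> symmetric_sq L)) =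
       card (classes_containing n (rrs_isotopic n) (\<lambda>L. idempotent_sq n L \<and> symmetric_sq L))
   \<and> card (classes_containing n (rrs_isotopic n) (\<lambda>L. idempotent_sq n L \<and> symmetric_sq L)) =
       card ({L \<in> latin_squares n. idempotent_sq n L \<and> symmetric_sq L} // isomorphic n)
   \<and> card ({L \<in> latin_squares n. idempotent_sq n L \<and> symmetric_sq L} // isomorphic n) =
       card (classes_containing (n + 1) (isomorphic (n + 1))
         (\<lambda>L. unipotent_sq L \<and> symmetric_sq L \<and> reduced_sq (n + 1) L))"
proof -
  define A where "A = {L \<in> latin_squares n. idempotent_sq n L \<and> symmetric_sq L}"
  define B where "B = {N \<in> latin_squares (n + 1). unipotent_sq N \<and> symmetric_sq N \<and> reduced_sq (n + 1) N}"
  have A: "L \<in> A \<longleftrightarrow> latin_square n L \<and> idempotent_sq n L \<and> symmetric_sq L" for L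
    by (auto simp: A_def latin_squares_def)
  have B: "N \<in> B \<longleftrightarrow> latin_square (n + 1) N \<and> unipotent_sq N \<and> symmetric_sq N \<and> reduced_sq (n + 1) N" for N
    by (auto simp: B_def latin_squares_def)
  have A_sub: "A \<subseteq> latin_squares n" by (auto simp: A_def)
  \<comment> \<open>For any \<open>P\<close> between membership in \<open>A\<close> and symmetry,
    the species meeting \<open>P\<close> are those meeting \<open>A\<close>. This serves the
    symmetric and the diagonal symmetric counts.\<close>
  have "card (A // paratopic n) = card ({L \<in> latin_squares n. P L} // paratopic n)"
    if "\<And>L. L \<in> A \<Longrightarrow> P L" "\<And>L. P L \<Longrightarrow> symmetric_sq L" for P
  proof (rule card_quotient_eq[OF equiv_paratopic equiv_paratopic A_sub, where f = id])
    show "\<exists>K\<in>A. (id K, L) \<in> paratopic n" if L: "L \<in> {L \<in> latin_squares n. P L}" for L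
    proof -
      have "latin_square n L" "symmetric_sq L"
        using L \<open>\<And>L. P L \<Longrightarrow> symmetric_sq L\<close> by (auto simp: latin_squares_def)
      then show ?thesis
        using paratopic_to_idempotent_symmetric[OF _ _ assms] A by (metis id_apply)
    qed
  qed (use that A_sub in auto)
  note paratopic_card = this
  \<comment> \<open>On \<open>A\<close> a paratopism gives an isotopism and then an isomorphism, so
    every relation between \<open>isomorphic n\<close> and \<open>paratopic n\<close> agrees with
    isomorphism there.\<close>
  have "card (A // R) = card (A // isomorphic n)"
    if "equiv (latin_squares n) R" "isomorphic n \<subseteq> R" "R \<subseteq> paratopic n" for R
  proof (rule card_quotient_eq[OF that(1) equiv_isomorphic A_sub A_sub, where f = id])
    show "(L, M) \<in> R \<longleftrightarrow> (id L, id M) \<in> isomorphic n" if "L \<in> A" "M \<in> A" for L M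
      using that \<open>isomorphic n \<subseteq> R\<close> \<open>R \<subseteq> paratopic n\<close> paratopic_symmetric_imp_isotopic
        isotopic_idempotent_symmetric_imp_isomorphic unfolding A id_apply by blast
    show "\<exists>L\<in>A. (id L, M) \<in> isomorphic n" if "M \<in> A" for M
      using that equiv_isomorphic[of n] A_sub unfolding equiv_def refl_on_def by auto
  qed auto
  note idempotent_card = this
  \<comment> \<open>\<open>prolong n\<close> transports isomorphism classes, and every member of
    \<open>B\<close> is the prolongation of its \<open>unprolong\<close>.\<close>
  have "card (A // isomorphic n) = card (B // isomorphic (n + 1))"
  proof (rule card_quotient_eq[OF equiv_isomorphic equiv_isomorphic A_sub, where f = "prolong n"])
    show "B \<subseteq> latin_squares (n + 1)" by (auto simp: B_def)
    show "prolong n ` A \<subseteq> B" using latin_square_prolong prolong_properties A B by blast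
    show "(L, M) \<in> isomorphic n \<longleftrightarrow> (prolong n L, prolong n M) \<in> isomorphic (n + 1)"
      if "L \<in> A" "M \<in> A" for L M
      using that isomorphic_prolong_iff A by blast
    fix N assume N: "N \<in> B"
    then have "unprolong n N \<in> A" "prolong n (unprolong n N) = N"
      using latin_square_unprolong unprolong_idempotent unprolong_symmetric prolong_unprolong A B by blast+
    moreover have "(N, N) \<in> isomorphic (n + 1)"
      using N equiv_isomorphic[of "n + 1"] unfolding B_def equiv_def refl_on_def by auto
    ultimately show "\<exists>L\<in>A. (prolong n L, N) \<in> isomorphic (n + 1)" by metis
  qed
  moreover have "isomorphic n \<subseteq> isotopic n" "isomorphic n \<subseteq> paratopic n" "rrs_isotopic n \<subseteq> paratopic n"
    using isomorphic_imp_rrs rrs_imp_isotopic isotopic_imp_paratopic by blast+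
  then have "card (A // paratopic n) = card (A // isomorphic n)"
      "card (A // isotopic n) = card (A // isomorphic n)"
      "card (A // rrs_isotopic n) = card (A // isomorphic n)"
    using idempotent_card[OF equiv_paratopic] idempotent_card[OF equiv_isotopic]
      idempotent_card[OF equiv_rrs_isotopic] isomorphic_imp_rrs isotopic_imp_paratopic by simp_all
  moreover have "card (A // paratopic n) = card ({L \<in> latin_squares n. symmetric_sq L} // paratopic n)"
    by (rule paratopic_card) (auto simp: A)
  moreover have "card (A // paratopic n) =
      card ({L \<in> latin_squares n. diagonal_sq L \<and> symmetric_sq L} // paratopic n)"
    by (rule paratopic_card) (auto simp: A dest: idempotent_imp_diagonal)
  ultimately show ?thesis
    unfolding classes_containing_eq_quotient[OF equiv_paratopic]
      classes_containing_eq_quotient[OF equiv_isotopic]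
      classes_containing_eq_quotient[OF equiv_rrs_isotopic]
      classes_containing_eq_quotient[OF equiv_isomorphic]
      A_def[symmetric] B_def[symmetric]
    by simp
qed

end
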